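(* Let $\mathbb{K}\in\{\mathbb{R},\mathbb{C}\}$ and let $X$ and $Y$ be Banach sequence lattices over $\mathbb{K}$. Suppose the following. 1. $X$ is $p$-convex with constant one. 2. $Y$ is $s$-convex with constant one. 3. $Y^*$ has modulus of convexity of power type $q$, where $2\le q<p$. 4. $X^*$ has modulus of convexity of power type $r$, where $2\le r<s$. Then, for every $\varepsilon>0$, there exists $\eta>0$ with the following property: whenever $x_0\in S_X$ and $y_0\in S_Y$ are finitely supported, with $F=\operatorname{supp}x_0$ and $G=\operatorname{supp}y_0$, and $A\in B_{\mathcal{L}(^2X\times Y;\mathbb{K})}$ satisfies $|A(x_0,y_0)|>1-\eta$, then $$\|A-R_{F,G}A\|<\varepsilon,$$ where $R_{F,G}A(x,y):=A(\pi_Fx,\pi_Gy)$ for $(x,y)\in X\times Y$.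
   Context: $B_E$ and $S_E$ denote the closed unit ball and the unit sphere of a Banach space $E$. A Banach sequence lattice over $\mathbb{K}$ is a linear subspace $X\subseteq\mathbb{K}^{\mathbb{N}}$ containing $c_{00}$ (the finitely supported sequences) which is a Banach space under a norm $\|\cdot\|_X$ and such that whenever $x\in X$, $y\in\mathbb{K}^{\mathbb{N}}$ and $|y(k)|\le|x(k)|$ for every $k$, then $y\in X$ and $\|y\|_X\le\|x\|_X$. For $1\le r<\infty$, $X$ is $r$-convex with constant one if $\big\|\big(\sum_{j=1}^m|x^j|^r\big)^{1/r}\big\|_X\le\big(\sum_{j=1}^m\|x^j\|_X^r\big)^{1/r}$ for every finite family $x^1,\dots,x^m\in X$ (operations coordinatewise). For finite $F\subseteq\mathbb{N}$, $\pi_F(x)=\sum_{k\in F}x(k)e_k$. The modulus of convexity of a Banach space $E$ is $\delta_E(\varepsilon)=\inf\{1-\tfrac12\|x+y\|:x,y\in B_E,\ \|x-y\|\ge\varepsilon\}$ for $0<\varepsilon\le2$; $E$ has modulus of convexity of power type $q$ (with $q\ge2$) if there is $C>0$ with $\delta_E(\varepsilon)\ge C\varepsilon^q$ for every $0<\varepsilon\le2$. $\mathcal{L}(^2X\times Y;\mathbb{K})$ is the Banach space of continuous bilinear forms $A:X\times Y\to\mathbb{K}$ with norm $\|A\|=\sup\{|A(x,y)|:x\in B_X,\,y\in B_Y\}$. *)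

theory Defs
  imports Complex_Main "HOL-Library.Function_Algebras"
begin

text \<open>
  The scalar field \<open>\<bbbK> \<in> {\<real>, \<complex>}\<close>: a type of this class is a copy of \<open>\<real>\<close> or of \<open>\<complex>\<close>, with the
  field structure and the absolute value transported along \<open>\<phi>\<close>.
\<close>

class real_or_complex = real_normed_field +
  assumes real_or_complex:
    "\<exists>\<phi> :: 'a \<Rightarrow> complex.
       (\<forall>a b. \<phi> (a + b) = \<phi> a + \<phi> b) \<and> (\<forall>a b. \<phi> (a * b) = \<phi> a * \<phi> b) \<and>
       (\<forall>t a. \<phi> (t *\<^sub>R a) = t *\<^sub>R \<phi> a) \<and> (\<forall>a. cmod (\<phi> a) = norm a) \<and>
       (range \<phi> = \<real> \<or> range \<phi> = UNIV)"

instance real :: real_or_complex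
  by standard (rule exI[of _ complex_of_real], auto simp: Reals_def scaleR_conv_of_real)

instance complex :: real_or_complex
  by standard (rule exI[of _ id], auto)

text \<open>
  Vector spaces over \<open>\<bbbK>\<close> are represented by a carrier set of \<open>\<bbbK>\<close>-valued functions together with a
  norm on that set; values of the norm off the carrier are irrelevant. Addition is the pointwise
  one of \<^theory>\<open>HOL-Library.Function_Algebras\<close>.
\<close>

definition fscale :: "'k::field \<Rightarrow> ('i \<Rightarrow> 'k) \<Rightarrow> 'i \<Rightarrow> 'k"
  where "fscale c x = (\<lambda>i. c * x i)"

global_interpretation fun_space: vector_space fscale
  by standard (auto simp: fscale_def fun_eq_iff algebra_simps)

definition normed_space_on :: "('i \<Rightarrow> 'k::real_normed_field) set \<Rightarrow> (('i \<Rightarrow> 'k) \<Rightarrow> real) \<Rightarrow> bool"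
  where "normed_space_on E N \<longleftrightarrow>
    fun_space.subspace E \<and>
    (\<forall>x\<in>E. 0 \<le> N x) \<and>
    (\<forall>x\<in>E. N x = 0 \<longleftrightarrow> x = 0) \<and>
    (\<forall>c. \<forall>x\<in>E. N (fscale c x) = norm c * N x) \<and>
    (\<forall>x\<in>E. \<forall>y\<in>E. N (x + y) \<le> N x + N y)"

definition banach_space_on :: "('i \<Rightarrow> 'k::real_normed_field) set \<Rightarrow> (('i \<Rightarrow> 'k) \<Rightarrow> real) \<Rightarrow> bool"
  where "banach_space_on E N \<longleftrightarrow>
    normed_space_on E N \<and>
    (\<forall>u :: nat \<Rightarrow> 'i \<Rightarrow> 'k.
       (\<forall>n. u n \<in> E) \<and> (\<forall>e>0. \<exists>n0. \<forall>m\<ge>n0. \<forall>n\<ge>n0. N (u m - u n) < e) \<longrightarrow>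
       (\<exists>x\<in>E. (\<lambda>n. N (u n - x)) \<longlonglongrightarrow> 0))"

definition unit_ball :: "'v set \<Rightarrow> ('v \<Rightarrow> real) \<Rightarrow> 'v set"
  where "unit_ball E N = {x \<in> E. N x \<le> 1}"

definition unit_sphere :: "'v set \<Rightarrow> ('v \<Rightarrow> real) \<Rightarrow> 'v set"
  where "unit_sphere E N = {x \<in> E. N x = 1}"

definition supp :: "('i \<Rightarrow> 'k::zero) \<Rightarrow> 'i set"
  where "supp x = {i. x i \<noteq> 0}"

definition banach_sequence_lattice ::
    "(nat \<Rightarrow> 'k::real_normed_field) set \<Rightarrow> ((nat \<Rightarrow> 'k) \<Rightarrow> real) \<Rightarrow> bool"
  where "banach_sequence_lattice X N \<longleftrightarrow>
    {x. finite (supp x)} \<subseteq> X \<and>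
    banach_space_on X N \<and>
    (\<forall>x\<in>X. \<forall>y. (\<forall>k. norm (y k) \<le> norm (x k)) \<longrightarrow> y \<in> X \<and> N y \<le> N x)"

definition convex_const_one ::
    "(nat \<Rightarrow> 'k::real_normed_field) set \<Rightarrow> ((nat \<Rightarrow> 'k) \<Rightarrow> real) \<Rightarrow> real \<Rightarrow> bool"
  where "convex_const_one X N r \<longleftrightarrow>
    1 \<le> r \<and>
    (\<forall>(m::nat) (x :: nat \<Rightarrow> nat \<Rightarrow> 'k). (\<forall>j<m. x j \<in> X) \<longrightarrow>
       N (\<lambda>k. of_real ((\<Sum>j<m. norm (x j k) powr r) powr (1 / r)))
         \<le> (\<Sum>j<m. N (x j) powr r) powr (1 / r))"

definition unit_vec :: "nat \<Rightarrow> nat \<Rightarrow> 'k::field"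
  where "unit_vec k = (\<lambda>i. if i = k then 1 else 0)"

definition coord_proj :: "nat set \<Rightarrow> (nat \<Rightarrow> 'k::field) \<Rightarrow> nat \<Rightarrow> 'k"
  where "coord_proj F x = (\<Sum>k\<in>F. fscale (x k) (unit_vec k))"

text \<open>
  For \<open>0 < \<epsilon> \<le> 2\<close> and \<open>E \<noteq> 0\<close> the infimum is over a nonempty set (it contains \<open>(x, -x)\<close> with \<open>x\<close> of
  norm one) of nonnegative numbers, so the total operator \<open>INF\<close> on the reals is the true infimum.
\<close>

definition modulus_of_convexity :: "'v::ab_group_add set \<Rightarrow> ('v \<Rightarrow> real) \<Rightarrow> real \<Rightarrow> real"
  where "modulus_of_convexity E N \<epsilon> =
    (INF (x, y) \<in> {(x, y). x \<in> unit_ball E N \<and> y \<in> unit_ball E N \<and> N (x - y) \<ge> \<epsilon>}.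
       1 - N (x + y) / 2)"

definition convexity_power_type :: "'v::ab_group_add set \<Rightarrow> ('v \<Rightarrow> real) \<Rightarrow> real \<Rightarrow> bool"
  where "convexity_power_type E N q \<longleftrightarrow>
    (\<exists>C>0. \<forall>\<epsilon>. 0 < \<epsilon> \<and> \<epsilon> \<le> 2 \<longrightarrow> modulus_of_convexity E N \<epsilon> \<ge> C * \<epsilon> powr q)"

definition linear_form_on :: "('i \<Rightarrow> 'k::field) set \<Rightarrow> (('i \<Rightarrow> 'k) \<Rightarrow> 'k) \<Rightarrow> bool"
  where "linear_form_on E f \<longleftrightarrow>
    (\<forall>x\<in>E. \<forall>y\<in>E. f (x + y) = f x + f y) \<and> (\<forall>c. \<forall>x\<in>E. f (fscale c x) = c * f x)"

text \<open>
  Functionals on \<open>E\<close> and forms on \<open>X \<times> Y\<close> are extended by \<open>0\<close> off their domain, so that each of them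
  is represented by exactly one HOL function and the pointwise operations stay in the carrier.
\<close>

definition dual_space ::
    "('i \<Rightarrow> 'k::real_normed_field) set \<Rightarrow> (('i \<Rightarrow> 'k) \<Rightarrow> real) \<Rightarrow> (('i \<Rightarrow> 'k) \<Rightarrow> 'k) set"
  where "dual_space E N = {f.
    linear_form_on E f \<and>
    (\<forall>a\<in>E. \<forall>e>0. \<exists>d>0. \<forall>x\<in>E. N (x - a) < d \<longrightarrow> norm (f x - f a) < e) \<and>
    (\<forall>x. x \<notin> E \<longrightarrow> f x = 0)}"

definition dual_norm ::
    "('i \<Rightarrow> 'k::real_normed_field) set \<Rightarrow> (('i \<Rightarrow> 'k) \<Rightarrow> real) \<Rightarrow> (('i \<Rightarrow> 'k) \<Rightarrow> 'k) \<Rightarrow> real"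
  where "dual_norm E N f = (SUP x \<in> unit_ball E N. norm (f x))"

definition bilinear_forms ::
    "('i \<Rightarrow> 'k::real_normed_field) set \<Rightarrow> (('i \<Rightarrow> 'k) \<Rightarrow> real) \<Rightarrow>
     ('j \<Rightarrow> 'k) set \<Rightarrow> (('j \<Rightarrow> 'k) \<Rightarrow> real) \<Rightarrow> (('i \<Rightarrow> 'k) \<Rightarrow> ('j \<Rightarrow> 'k) \<Rightarrow> 'k) set"
  where "bilinear_forms X NX Y NY = {A.
    (\<forall>x\<in>X. linear_form_on Y (\<lambda>y. A x y)) \<and>
    (\<forall>y\<in>Y. linear_form_on X (\<lambda>x. A x y)) \<and>
    (\<forall>a\<in>X. \<forall>b\<in>Y. \<forall>e>0. \<exists>d>0. \<forall>x\<in>X. \<forall>y\<in>Y.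
       NX (x - a) < d \<and> NY (y - b) < d \<longrightarrow> norm (A x y - A a b) < e) \<and>
    (\<forall>x y. x \<notin> X \<or> y \<notin> Y \<longrightarrow> A x y = 0)}"

definition bilinear_norm ::
    "('i \<Rightarrow> 'k::real_normed_field) set \<Rightarrow> (('i \<Rightarrow> 'k) \<Rightarrow> real) \<Rightarrow>
     ('j \<Rightarrow> 'k) set \<Rightarrow> (('j \<Rightarrow> 'k) \<Rightarrow> real) \<Rightarrow> (('i \<Rightarrow> 'k) \<Rightarrow> ('j \<Rightarrow> 'k) \<Rightarrow> 'k) \<Rightarrow> real"
  where "bilinear_norm X NX Y NY A =
    (SUP (x, y) \<in> unit_ball X NX \<times> unit_ball Y NY. norm (A x y))"

definition restrict_form ::
    "(nat \<Rightarrow> 'k::field) set \<Rightarrow> (nat \<Rightarrow> 'k) set \<Rightarrow> nat set \<Rightarrow> nat set \<Rightarrow>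
     ((nat \<Rightarrow> 'k) \<Rightarrow> (nat \<Rightarrow> 'k) \<Rightarrow> 'k) \<Rightarrow> (nat \<Rightarrow> 'k) \<Rightarrow> (nat \<Rightarrow> 'k) \<Rightarrow> 'k"
  where "restrict_form X Y F G A =
    (\<lambda>x y. if x \<in> X \<and> y \<in> Y then A (coord_proj F x) (coord_proj G y) else 0)"

end

theory Submission
  imports Defs
begin

text \<open>
  If \<open>z\<close> is disjointly supported from \<open>x\<^sub>0\<close>, then \<open>p\<close>-convexity of \<open>X\<close> gives
  \<open>\<parallel>x\<^sub>0 \<plusminus> t z\<parallel> \<le> (1 + t\<^sup>p)\<^sup>1\<^sup>/\<^sup>p\<close>. Normalise the functionals \<open>A(x\<^sub>0 \<plusminus> t z, \<cdot>)\<close> on \<open>Y\<close> accordingly: their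
  midpoint has norm at least \<open>1 - 2 t\<^sup>p\<close> once \<open>\<bar>A(x\<^sub>0, y\<^sub>0)\<bar> > 1 - t\<^sup>p\<close>, so the convexity of \<open>Y\<^sup>*\<close> forces
  \<open>(t \<parallel>A(z, \<cdot>)\<parallel>)\<^sup>q \<lesssim> t\<^sup>p\<close>. As \<open>q < p\<close>, the norm of \<open>A(z, \<cdot>)\<close> is small. The same argument in the other
  variable and \<open>A(x, y) - A(\<pi>\<^sub>F x, \<pi>\<^sub>G y) = A(x - \<pi>\<^sub>F x, y) + A(\<pi>\<^sub>F x, y - \<pi>\<^sub>G y)\<close> finish the proof.
\<close>

section \<open>Normed spaces on carriers, dual norms and the modulus of convexity of a dual\<close>

lemma normed_space_onD:
  assumes "normed_space_on E N"
  shows "0 \<in> E" "N 0 = 0"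
    and "x \<in> E \<Longrightarrow> y \<in> E \<Longrightarrow> x + y \<in> E"
    and "x \<in> E \<Longrightarrow> y \<in> E \<Longrightarrow> x - y \<in> E"
    and "x \<in> E \<Longrightarrow> fscale c x \<in> E"
    and "x \<in> E \<Longrightarrow> 0 \<le> N x"
    and "x \<in> E \<Longrightarrow> N (fscale c x) = norm c * N x"
  using assms unfolding normed_space_on_def
  by (auto simp: fun_space.subspace_0 fun_space.subspace_add fun_space.subspace_diff
      fun_space.subspace_scale)

lemma linear_form_on_zero:
  assumes "normed_space_on E N" "linear_form_on E f"
  shows "f 0 = 0"
proof -
  have "f (fscale 0 0) = 0 * f 0"
    using assms normed_space_onD(1)[OF assms(1)] unfolding linear_form_on_def by blast
  then show ?thesis by simp
qed

lemma fscale_unit_ball: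
  assumes E: "normed_space_on E N" and d: "0 < d" and x: "x \<in> unit_ball E N"
  shows "fscale (of_real (d / 2)) x \<in> E" "N (fscale (of_real (d / 2)) x) < d"
proof -
  have "N (fscale (of_real (d / 2)) x) = d / 2 * N x"
    using normed_space_onD(7)[OF E] x d by (auto simp: unit_ball_def simp del: of_real_divide)
  also have "\<dots> \<le> d / 2 * 1"
    using x d by (intro mult_left_mono) (auto simp: unit_ball_def)
  finally show "N (fscale (of_real (d / 2)) x) < d" using d by simp
  show "fscale (of_real (d / 2)) x \<in> E"
    using normed_space_onD(5)[OF E] x by (auto simp: unit_ball_def)
qed

text \<open>Continuity at 0 bounds \<open>f\<close> by 1 on the ball of radius \<open>d\<close>, and
  rescaling by \<open>d / 2\<close> carries this to the unit ball. A \<open>SUP\<close> over the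
  reals is informative only for bounded sets, so every later use of \<open>dual_norm\<close> as an
  upper bound rests on this.\<close>

lemma dual_space_bdd_above:
  assumes E: "normed_space_on E N" and f: "f \<in> dual_space E N"
  shows "bdd_above ((\<lambda>x. norm (f x)) ` unit_ball E N)"
proof -
  have lin: "linear_form_on E f" using f by (simp add: dual_space_def)
  have "0 \<in> E" by (rule normed_space_onD(1)[OF E])
  then obtain d where d: "0 < d" "\<And>x. x \<in> E \<Longrightarrow> N x < d \<Longrightarrow> norm (f x) < 1"
    using f zero_less_one unfolding dual_space_def mem_Collect_eq
    by (metis (no_types, lifting) diff_zero linear_form_on_zero[OF E lin])
  have "norm (f x) \<le> 2 / d" if x: "x \<in> unit_ball E N" for x
  proof -
    have "f (fscale (of_real (d / 2)) x) = of_real (d / 2) * f x"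
      using lin x unfolding linear_form_on_def unit_ball_def by blast
    moreover have "norm (f (fscale (of_real (d / 2)) x)) < 1"
      using fscale_unit_ball[OF E d(1) x] by (rule d(2))
    ultimately have "d / 2 * norm (f x) < 1"
      using d(1) by (simp add: norm_mult del: of_real_divide)
    then show ?thesis using d(1) by (simp add: field_simps)
  qed
  then show ?thesis by (auto simp: bdd_above_def)
qed

lemma norm_le_dual_norm:
  assumes "normed_space_on E N" "f \<in> dual_space E N" "x \<in> unit_ball E N"
  shows "norm (f x) \<le> dual_norm E N f"
  unfolding dual_norm_def
  by (rule cSUP_upper[OF assms(3) dual_space_bdd_above[OF assms(1,2)]])

lemma zero_in_unit_ball: "normed_space_on E N \<Longrightarrow> 0 \<in> unit_ball E N"
  by (simp add: unit_ball_def normed_space_onD)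

lemma dual_norm_le:
  assumes "normed_space_on E N" "\<And>x. x \<in> unit_ball E N \<Longrightarrow> norm (f x) \<le> b"
  shows "dual_norm E N f \<le> b"
  unfolding dual_norm_def
  using zero_in_unit_ball[OF assms(1)] by (intro cSUP_least assms(2)) auto

text \<open>The bound on the sum makes the quantities under the infimum in the modulus nonnegative.
  The bound on the difference places it in the range of arguments up to 2 covered by the power
  type.\<close>

lemma dual_norm_add_le_2:
  assumes E: "normed_space_on E N"
    and f: "f \<in> unit_ball (dual_space E N) (dual_norm E N)"
    and g: "g \<in> unit_ball (dual_space E N) (dual_norm E N)"
  shows "dual_norm E N (f + g) \<le> 2" "dual_norm E N (f - g) \<le> 2"
proof -
  have "norm (f x) \<le> 1 \<and> norm (g x) \<le> 1" if "x \<in> unit_ball E N" for x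
    using norm_le_dual_norm[OF E _ that] f g unfolding unit_ball_def by force
  then have "norm (f x + g x) \<le> 2 \<and> norm (f x - g x) \<le> 2" if "x \<in> unit_ball E N" for x
    using that norm_triangle_ineq[of "f x" "g x"] norm_triangle_ineq4[of "f x" "g x"] by force
  then show "dual_norm E N (f + g) \<le> 2" "dual_norm E N (f - g) \<le> 2"
    by (auto intro!: dual_norm_le[OF E])
qed

text \<open>With the argument of the modulus equal to the distance of \<open>f\<close> and
  \<open>g\<close>, the pair itself competes in the infimum. The infimum is a lower bound because
  the set is bounded below by 0.\<close>

lemma modulus_of_convexity_dual_le:
  assumes E: "normed_space_on E N"
    and f: "f \<in> unit_ball (dual_space E N) (dual_norm E N)"
    and g: "g \<in> unit_ball (dual_space E N) (dual_norm E N)"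
  shows "modulus_of_convexity (dual_space E N) (dual_norm E N) (dual_norm E N (f - g))
    \<le> 1 - dual_norm E N (f + g) / 2"
proof -
  let ?S = "{(x, y). x \<in> unit_ball (dual_space E N) (dual_norm E N) \<and>
    y \<in> unit_ball (dual_space E N) (dual_norm E N) \<and>
    dual_norm E N (x - y) \<ge> dual_norm E N (f - g)}"
  have "bdd_below ((\<lambda>(x, y). 1 - dual_norm E N (x + y) / 2) ` ?S)"
    using dual_norm_add_le_2(1)[OF E] by (intro bdd_belowI[of _ 0]) force
  moreover have "(f, g) \<in> ?S" using f g by simp
  ultimately show ?thesis unfolding modulus_of_convexity_def
    by (metis (no_types, lifting) cINF_lower case_prod_conv)
qed

section \<open>Coordinate projections and disjoint supports in sequence lattices\<close>

lemma coord_proj_apply: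
  assumes "finite F"
  shows "coord_proj F x k = (if k \<in> F then x k else 0)"
proof -
  have "coord_proj F x k = (\<Sum>j\<in>F. fscale (x j) (unit_vec j) k)"
    unfolding coord_proj_def using assms by (induction F rule: finite_induct) auto
  also have "\<dots> = (\<Sum>j\<in>F. if j = k then x j else 0)"
    by (intro sum.cong) (auto simp: fscale_def unit_vec_def)
  finally show ?thesis using assms by simp
qed

lemma banach_sequence_lattice_normed_space:
  "banach_sequence_lattice X N \<Longrightarrow> normed_space_on X N"
  by (simp add: banach_sequence_lattice_def banach_space_on_def)

lemma banach_sequence_lattice_mono:
  assumes "banach_sequence_lattice X N" "x \<in> X" "\<And>k. norm (y k) \<le> norm (x k)"
  shows "y \<in> X" "N y \<le> N x"
  using assms unfolding banach_sequence_lattice_def by blast+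

lemma unit_ball_coord_proj:
  assumes X: "banach_sequence_lattice X N" and F: "finite F" and x: "x \<in> unit_ball X N"
  shows "coord_proj F x \<in> unit_ball X N" "x - coord_proj F x \<in> unit_ball X N"
proof -
  have x': "x \<in> X" "N x \<le> 1" using x by (auto simp: unit_ball_def)
  have "norm (coord_proj F x k) \<le> norm (x k)" "norm ((x - coord_proj F x) k) \<le> norm (x k)" for k
    by (simp_all add: coord_proj_apply[OF F])
  then show "coord_proj F x \<in> unit_ball X N" "x - coord_proj F x \<in> unit_ball X N"
    using banach_sequence_lattice_mono[OF X x'(1), of "coord_proj F x"]
      banach_sequence_lattice_mono[OF X x'(1), of "x - coord_proj F x"] x'(2)
    unfolding unit_ball_def by force+
qed

text \<open>For disjoint supports at most one term of the coordinatewise \<open>p\<close>-sum is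
  nonzero, so that sum is the modulus of \<open>x + y\<close>. The lattice norm depends only on
  moduli, and convexity for a family of two vectors applies.\<close>

lemma convex_const_one_disjoint:
  assumes X: "banach_sequence_lattice X N" and cv: "convex_const_one X N p"
    and x: "x \<in> X" and y: "y \<in> X" and disj: "\<And>k. x k = 0 \<or> y k = 0"
  shows "N (x + y) \<le> (N x powr p + N y powr p) powr (1 / p)"
proof -
  have p: "1 \<le> p" using cv by (simp add: convex_const_one_def)
  define u where "u = (\<lambda>j::nat. if j = 0 then x else y)"
  define w :: "nat \<Rightarrow> 'a"
    where "w = (\<lambda>k. of_real ((\<Sum>j<2. norm (u j k) powr p) powr (1 / p)))"
  have "\<forall>j<2. u j \<in> X" using x y by (simp add: u_def)
  then have "N w \<le> (\<Sum>j<2. N (u j) powr p) powr (1 / p)"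
    using cv unfolding w_def convex_const_one_def by blast
  then have 1: "N w \<le> (N x powr p + N y powr p) powr (1 / p)"
    by (simp add: u_def numeral_2_eq_2)
  have w: "norm (w k) = norm ((x + y) k)" for k
    using disj[of k] p by (auto simp: w_def u_def numeral_2_eq_2 powr_powr)
  have "x + y \<in> X"
    using normed_space_onD(3)[OF banach_sequence_lattice_normed_space[OF X] x y] .
  then have "w \<in> X"
    by (rule banach_sequence_lattice_mono(1)[OF X]) (simp only: w order_refl)
  then have "N (x + y) \<le> N w"
    by (rule banach_sequence_lattice_mono(2)[OF X]) (simp only: w order_refl)
  with 1 show ?thesis by simp
qed

section \<open>Bilinear forms, their slices and their norm\<close>

lemma bilinear_forms_linear:
  assumes "A \<in> bilinear_forms X NX Y NY"
  shows "x \<in> X \<Longrightarrow> linear_form_on Y (A x)" "y \<in> Y \<Longrightarrow> linear_form_on X (\<lambda>x. A x y)"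
  using assms by (auto simp: bilinear_forms_def)

lemma bilinear_forms_flip:
  assumes "A \<in> bilinear_forms X NX Y NY"
  shows "(\<lambda>y x. A x y) \<in> bilinear_forms Y NY X NX"
proof -
  have "\<exists>d>0. \<forall>y\<in>Y. \<forall>x\<in>X. NY (y - b) < d \<and> NX (x - a) < d \<longrightarrow> norm (A x y - A a b) < e"
    if abe: "a \<in> X" "b \<in> Y" "0 < e" for a b e
  proof -
    obtain d where "d > 0"
      "\<forall>x\<in>X. \<forall>y\<in>Y. NX (x - a) < d \<and> NY (y - b) < d \<longrightarrow> norm (A x y - A a b) < e"
      using assms abe unfolding bilinear_forms_def by blast
    then show ?thesis by blast
  qed
  moreover have "A x y = 0" if "y \<notin> Y \<or> x \<notin> X" for x y
    using assms that by (auto simp: bilinear_forms_def)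
  ultimately show ?thesis using bilinear_forms_linear[OF assms] unfolding bilinear_forms_def
    by blast
qed

lemma bilinear_forms_dual_space:
  assumes X: "normed_space_on X NX" and A: "A \<in> bilinear_forms X NX Y NY" and x: "x \<in> X"
  shows "A x \<in> dual_space Y NY"
proof -
  have cont: "\<exists>d>0. \<forall>y\<in>Y. NY (y - a) < d \<longrightarrow> norm (A x y - A x a) < e"
    if ae: "a \<in> Y" "e > 0" for a e
  proof -
    obtain d where d: "d > 0"
      "\<forall>x'\<in>X. \<forall>y\<in>Y. NX (x' - x) < d \<and> NY (y - a) < d \<longrightarrow> norm (A x' y - A x a) < e"
      using A x ae unfolding bilinear_forms_def by blast
    \<comment> \<open>Freezing the first variable at \<open>x\<close> meets its half of the joint
      continuity condition trivially.\<close>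
    moreover have "NX (x - x) < d" using d(1) normed_space_onD(2)[OF X] by simp
    ultimately show ?thesis using x by blast
  qed
  show ?thesis
    using bilinear_forms_linear(1)[OF A x] cont A
    by (simp add: dual_space_def bilinear_forms_def)
qed

lemma norm_le_bilinear_norm:
  assumes X: "normed_space_on X NX" and Y: "normed_space_on Y NY"
    and A: "A \<in> bilinear_forms X NX Y NY"
    and x: "x \<in> unit_ball X NX" and y: "y \<in> unit_ball Y NY"
  shows "norm (A x y) \<le> bilinear_norm X NX Y NY A"
proof -
  have A0: "A 0 0 = 0"
    using linear_form_on_zero[OF Y bilinear_forms_linear(1)[OF A]] normed_space_onD(1)[OF X] .
  obtain d where d: "d > 0"
    "\<forall>x\<in>X. \<forall>y\<in>Y. NX (x - 0) < d \<and> NY (y - 0) < d \<longrightarrow> norm (A x y - A 0 0) < 1"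
    using A normed_space_onD(1)[OF X] normed_space_onD(1)[OF Y] zero_less_one
    unfolding bilinear_forms_def by blast
  \<comment> \<open>Scaling each variable by \<open>d / 2\<close> enters the neighbourhood of the
    origin where the form is below 1; the two factors multiply to the constant.\<close>
  have "norm (A x y) \<le> 4 / d\<^sup>2" if x: "x \<in> unit_ball X NX" and y: "y \<in> unit_ball Y NY" for x y
  proof -
    note x' = fscale_unit_ball[OF X d(1) x] and y' = fscale_unit_ball[OF Y d(1) y]
    let ?c = "of_real (d / 2) :: 'b"
    have "A (fscale ?c x) (fscale ?c y) = ?c * A (fscale ?c x) y"
      using bilinear_forms_linear(1)[OF A x'(1)] y
      unfolding linear_form_on_def unit_ball_def by blast
    also have "A (fscale ?c x) y = ?c * A x y"
      using bilinear_forms_linear(2)[OF A, of y] x y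
      unfolding linear_form_on_def unit_ball_def by blast
    finally have "norm (A (fscale ?c x) (fscale ?c y)) = d / 2 * (d / 2 * norm (A x y))"
      using d(1) by (simp add: norm_mult del: of_real_divide)
    moreover have "norm (A (fscale ?c x) (fscale ?c y)) < 1"
      using d(2) x' y' A0 by simp
    ultimately show ?thesis using d(1) by (simp add: field_simps power2_eq_square)
  qed
  then have "bdd_above ((\<lambda>(x, y). norm (A x y)) ` (unit_ball X NX \<times> unit_ball Y NY))"
    by (intro bdd_aboveI[of _ "4 / d\<^sup>2"]) auto
  from cSUP_upper[OF _ this, of "(x, y)"] show ?thesis
    using x y by (simp add: bilinear_norm_def)
qed

lemma bilinear_norm_le:
  assumes X: "normed_space_on X NX" and Y: "normed_space_on Y NY"
    and "\<And>x y. x \<in> unit_ball X NX \<Longrightarrow> y \<in> unit_ball Y NY \<Longrightarrow> norm (A x y) \<le> b"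
  shows "bilinear_norm X NX Y NY A \<le> b"
  unfolding bilinear_norm_def
  using zero_in_unit_ball[OF X] zero_in_unit_ball[OF Y] by (intro cSUP_least) (auto intro: assms)

section \<open>Convexity estimate for vectors disjoint from \<open>x0\<close>\<close>

lemma bilinear_disjoint_estimate:
  assumes X: "banach_sequence_lattice X NX" and Y: "normed_space_on Y NY"
    and cv: "convex_const_one X NX p"
    and C: "0 < C" "\<And>\<epsilon>. 0 < \<epsilon> \<Longrightarrow> \<epsilon> \<le> 2 \<Longrightarrow>
      C * \<epsilon> powr q \<le> modulus_of_convexity (dual_space Y NY) (dual_norm Y NY) \<epsilon>"
    and q: "0 < q" and t: "0 < t" "t \<le> 1"
    and Aball: "A \<in> unit_ball (bilinear_forms X NX Y NY) (bilinear_norm X NX Y NY)"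
    and x0: "x0 \<in> unit_sphere X NX" and y0: "y0 \<in> unit_ball Y NY"
    and att: "norm (A x0 y0) > 1 - t powr p"
    and z: "z \<in> unit_ball X NX" and disj: "\<And>k. x0 k = 0 \<or> z k = 0"
    and y: "y \<in> unit_ball Y NY"
  shows "C * (t * norm (A z y)) powr q \<le> 2 * t powr p"
\<comment> \<open>The zero case is separated because the power type bounds the modulus only at
  positive arguments.\<close>
proof (cases "A z y = 0")
  case True
  then show ?thesis by simp
next
  case False
  note NX = banach_sequence_lattice_normed_space[OF X]
  have A: "A \<in> bilinear_forms X NX Y NY" using Aball by (simp add: unit_ball_def)
  have A1: "norm (A x y) \<le> 1" if "x \<in> unit_ball X NX" "y \<in> unit_ball Y NY" for x y
    using norm_le_bilinear_norm[OF NX Y A that] Aball by (simp add: unit_ball_def)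
  have p: "1 \<le> p" using cv by (simp add: convex_const_one_def)
  have xX: "x0 \<in> X" "NX x0 = 1" and zX: "z \<in> X" "NX z \<le> 1" and yY: "y \<in> Y" "y0 \<in> Y"
    using x0 z y y0 by (auto simp: unit_sphere_def unit_ball_def)
  \<comment> \<open>\<open>c\<close> bounds the norm of \<open>x0\<close> plus or minus
    \<open>t\<close> times \<open>z\<close>. Since 1/p is at most 1 and the base is at least 1,
    \<open>c\<close> is at most \<open>1 + t powr p\<close>, hence at most 2.\<close>
  define c where "c = (1 + t powr p) powr (1 / p)"
  have u: "0 < t powr p" "t powr p \<le> 1"
    using t p by (auto intro: powr_le1)
  have "c \<le> (1 + t powr p) powr 1"
    unfolding c_def using p u by (intro powr_mono) auto
  then have c: "c \<le> 1 + t powr p" "c \<le> 2" using u by auto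
  have c0: "0 < c" using add_pos_pos[OF zero_less_one u(1)] by (simp add: c_def)
  \<comment> \<open>The sign \<open>\<sigma>\<close> selects one of the two perturbations of
    \<open>x0\<close>; division by \<open>c\<close> brings both into the unit ball.\<close>
  define v where "v = (\<lambda>\<sigma>::real. fscale (of_real (1 / c)) (x0 + fscale (of_real (\<sigma> * t)) z))"
  have v: "v \<sigma> \<in> unit_ball X NX" if \<sigma>: "\<bar>\<sigma>\<bar> = 1" for \<sigma>
  proof -
    have z': "fscale (of_real (\<sigma> * t)) z \<in> X"
      using normed_space_onD(5)[OF NX zX(1)] .
    have w: "x0 + fscale (of_real (\<sigma> * t)) z \<in> X"
      using normed_space_onD(3)[OF NX xX(1) z'] .
    have "NX (fscale (of_real (\<sigma> * t)) z) = t * NX z"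
      using normed_space_onD(7)[OF NX zX(1), of "of_real (\<sigma> * t)"] \<sigma> t
      by (simp add: norm_mult abs_mult)
    also have "\<dots> \<le> t * 1" using t zX by (intro mult_left_mono) auto
    finally have "NX (fscale (of_real (\<sigma> * t)) z) \<le> t" by simp
    then have z'': "NX (fscale (of_real (\<sigma> * t)) z) powr p \<le> t powr p"
      using normed_space_onD(6)[OF NX z'] p by (intro powr_mono2) auto
    have "NX (x0 + fscale (of_real (\<sigma> * t)) z)
        \<le> (NX x0 powr p + NX (fscale (of_real (\<sigma> * t)) z) powr p) powr (1 / p)"
      using disj by (intro convex_const_one_disjoint[OF X cv xX(1) z']) (auto simp: fscale_def)
    also have "\<dots> \<le> c"
      unfolding c_def using xX(2) z'' p by (intro powr_mono2) auto
    finally have "NX (v \<sigma>) \<le> 1"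
      unfolding v_def normed_space_onD(7)[OF NX w] using c0 by (simp add: norm_divide)
    moreover have "v \<sigma> \<in> X" unfolding v_def using normed_space_onD(5)[OF NX w] .
    ultimately show ?thesis by (simp add: unit_ball_def)
  qed
  have dual: "A (v \<sigma>) \<in> unit_ball (dual_space Y NY) (dual_norm Y NY)" if "\<bar>\<sigma>\<bar> = 1" for \<sigma>
    using bilinear_forms_dual_space[OF NX A, of "v \<sigma>"] v[OF that] A1
    by (auto simp: unit_ball_def intro!: dual_norm_le[OF Y])
  have Av: "A (v \<sigma>) b = of_real (1 / c) * (A x0 b + of_real (\<sigma> * t) * A z b)"
    if "b \<in> Y" for b \<sigma>
    using bilinear_forms_linear(2)[OF A that] xX(1) zX(1) normed_space_onD(3,5)[OF NX]
    unfolding linear_form_on_def v_def by metis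
  let ?f = "A (v 1)" and ?g = "A (v (-1))"
  have f: "?f \<in> unit_ball (dual_space Y NY) (dual_norm Y NY)"
    and g: "?g \<in> unit_ball (dual_space Y NY) (dual_norm Y NY)" by (simp_all add: dual)
  have v': "v 1 \<in> X" "v (-1) \<in> X" using v[of 1] v[of "-1"] by (auto simp: unit_ball_def)
  have add: "?f + ?g = A (v 1 + v (-1))" and diff: "?f - ?g = A (v 1 - v (-1))"
  proof -
    have eq: "A (v 1 + v (-1)) b = A (v 1) b + A (v (-1)) b \<and>
      A (v 1 - v (-1)) b = A (v 1) b - A (v (-1)) b" for b
    proof (cases "b \<in> Y")
      case True
      have lin: "linear_form_on X (\<lambda>x. A x b)" by (rule bilinear_forms_linear(2)[OF A True])
      \<comment> \<open>\<open>linear_form_on\<close> speaks of sums only, so the rule for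
        differences comes from adding \<open>v (-1)\<close> back.\<close>
      have "A (v 1 - v (-1) + v (-1)) b = A (v 1 - v (-1)) b + A (v (-1)) b"
        using lin normed_space_onD(4)[OF NX v'] v' unfolding linear_form_on_def by blast
      moreover have "A (v 1 + v (-1)) b = A (v 1) b + A (v (-1)) b"
        using lin v' unfolding linear_form_on_def by blast
      ultimately show ?thesis by simp
    next
      case False
      then show ?thesis using A by (simp add: bilinear_forms_def)
    qed
    show "?f + ?g = A (v 1 + v (-1))" "?f - ?g = A (v 1 - v (-1))"
      using eq by (auto simp: fun_eq_iff)
  qed
  have fgd: "?f + ?g \<in> dual_space Y NY" "?f - ?g \<in> dual_space Y NY"
    unfolding add diff
    using bilinear_forms_dual_space[OF NX A] normed_space_onD(3,4)[OF NX v'] by blast+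
  define \<delta> where "\<delta> = dual_norm Y NY (?f - ?g)"
  \<comment> \<open>The sum cancels \<open>z\<close> and retains the almost attained value at
    \<open>x0\<close>; the difference cancels \<open>x0\<close> and retains the quantity to be
    bounded.\<close>
  have "(?f + ?g) y0 = of_real (2 / c) * A x0 y0" "(?f - ?g) y = of_real (2 * t / c) * A z y"
    using c0 by (simp_all add: Av yY field_simps)
  then have "norm ((?f + ?g) y0) = 2 / c * norm (A x0 y0)"
    "norm ((?f - ?g) y) = 2 * t / c * norm (A z y)"
    using c0 t(1) by (simp_all add: norm_mult norm_divide)
  then have sum_ge: "2 / c * norm (A x0 y0) \<le> dual_norm Y NY (?f + ?g)"
    and diff_ge: "2 * t / c * norm (A z y) \<le> \<delta>"
    using norm_le_dual_norm[OF Y fgd(1) y0] norm_le_dual_norm[OF Y fgd(2) y]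
    by (simp_all add: \<delta>_def)
  \<comment> \<open>This is where \<open>c\<close> being at most 2 enters.\<close>
  have "t * norm (A z y) \<le> 2 * t / c * norm (A z y)"
    using c c0 t by (intro mult_right_mono) (auto simp: field_simps)
  with diff_ge have \<delta>: "t * norm (A z y) \<le> \<delta>" by simp
  have "0 < t * norm (A z y)" using t False by simp
  with \<delta> have \<delta>0: "0 < \<delta>" by linarith
  have \<delta>2: "\<delta> \<le> 2" unfolding \<delta>_def by (rule dual_norm_add_le_2(2)[OF Y f g])
  have "C * (t * norm (A z y)) powr q \<le> C * \<delta> powr q"
    using C(1) \<delta> t q by (intro mult_left_mono powr_mono2) auto
  also have "\<dots> \<le> 1 - dual_norm Y NY (?f + ?g) / 2"
    using C(2)[OF \<delta>0 \<delta>2] modulus_of_convexity_dual_le[OF Y f g] by (simp add: \<delta>_def)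
  also have "\<dots> \<le> 1 - norm (A x0 y0) / c" using sum_ge by (simp add: mult.commute)
  also have "\<dots> \<le> 1 - (1 - t powr p) / (1 + t powr p)"
    using frac_le[of "norm (A x0 y0)" "1 - t powr p" c "1 + t powr p"] att c c0 u by simp
  also have "\<dots> \<le> 2 * t powr p"
  proof -
    \<comment> \<open>With u = t^p the left side is 1 - u - 2u^2.\<close>
    have "(1 - 2 * t powr p) * (1 + t powr p) \<le> 1 - t powr p"
      using u by (simp add: algebra_simps)
    then have "1 - 2 * t powr p \<le> (1 - t powr p) / (1 + t powr p)"
      by (simp only: pos_le_divide_eq[OF add_pos_pos[OF zero_less_one u(1)]])
    then show ?thesis by simp
  qed
  finally show ?thesis .
qed

text \<open>The number \<open>\<eta>\<close> is a power of \<open>t\<close>, and \<open>t\<close>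
  depends only on \<open>e\<close>, the exponents and the convexity constant; hence it is uniform in
  the vectors and the form.\<close>

lemma bilinear_small_off_support:
  fixes X :: "(nat \<Rightarrow> 'k::real_normed_field) set" and Y :: "('i \<Rightarrow> 'k) set"
  assumes X: "banach_sequence_lattice X NX" and Y: "normed_space_on Y NY"
    and cv: "convex_const_one X NX p"
    and pt: "convexity_power_type (dual_space Y NY) (dual_norm Y NY) q"
    and q: "0 < q" "q < p" and e: "0 < e"
  shows "\<exists>\<eta>>0. \<forall>x0 \<in> unit_sphere X NX. \<forall>y0 \<in> unit_sphere Y NY.
    \<forall>A \<in> unit_ball (bilinear_forms X NX Y NY) (bilinear_norm X NX Y NY).
      finite (supp x0) \<and> norm (A x0 y0) > 1 - \<eta> \<longrightarrow>
      (\<forall>x \<in> unit_ball X NX. \<forall>y \<in> unit_ball Y NY.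
        norm (A (x - coord_proj (supp x0) x) y) \<le> e)"
proof -
  obtain C where C: "0 < C" "\<And>\<epsilon>. 0 < \<epsilon> \<Longrightarrow> \<epsilon> \<le> 2 \<Longrightarrow>
      C * \<epsilon> powr q \<le> modulus_of_convexity (dual_space Y NY) (dual_norm Y NY) \<epsilon>"
    using pt unfolding convexity_power_type_def by blast
  \<comment> \<open>The second entry solves 2 t^(p-q) = C e^q, possible because
    \<open>q < p\<close>; the minimum with 1 keeps \<open>t\<close> admissible in the disjoint
    estimate.\<close>
  define t where "t = min 1 ((C / 2 * e powr q) powr (1 / (p - q)))"
  have t: "0 < t" "t \<le> 1" using C(1) e by (auto simp: t_def)
  have "t powr (p - q) \<le> ((C / 2 * e powr q) powr (1 / (p - q))) powr (p - q)"
    using t q by (intro powr_mono2) (auto simp: t_def)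
  also have "\<dots> = C / 2 * e powr q"
    using C(1) e q by (simp add: powr_powr)
  finally have te: "2 * t powr (p - q) \<le> C * e powr q" by simp
  show ?thesis
  proof (intro exI[of _ "t powr p"] conjI ballI impI; (elim conjE)?)
    show "0 < t powr p" using t by simp
    fix A and x0 x :: "nat \<Rightarrow> 'k" and y0 y :: "'i \<Rightarrow> 'k"
    assume x0: "x0 \<in> unit_sphere X NX" and y0: "y0 \<in> unit_sphere Y NY"
      and A: "A \<in> unit_ball (bilinear_forms X NX Y NY) (bilinear_norm X NX Y NY)"
      and F: "finite (supp x0)" and att: "norm (A x0 y0) > 1 - t powr p"
      and x: "x \<in> unit_ball X NX" and y: "y \<in> unit_ball Y NY"
    have y0': "y0 \<in> unit_ball Y NY" using y0 by (simp add: unit_ball_def unit_sphere_def)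
    \<comment> \<open>On the support of \<open>x0\<close> the projection removes every coordinate of
      \<open>x\<close>.\<close>
    have disj: "x0 k = 0 \<or> (x - coord_proj (supp x0) x) k = 0" for k
      by (cases "x0 k = 0") (simp_all add: coord_proj_apply[OF F], simp add: supp_def)
    define a where "a = norm (A (x - coord_proj (supp x0) x) y)"
    have "C * (t * a) powr q \<le> 2 * t powr p"
      unfolding a_def
      by (rule bilinear_disjoint_estimate[OF X Y cv C q(1) t A x0 y0' att
            unit_ball_coord_proj(2)[OF X F x] disj y])
    moreover have "(t * a) powr q = t powr q * a powr q"
      using t by (simp add: a_def powr_mult)
    moreover have "t powr p = t powr q * t powr (p - q)"
      using t by (simp flip: powr_add)
    \<comment> \<open>Splitting t^p as t^q t^(p-q) lets the common factor cancel, leaving exactly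
      the quantity controlled by the choice of \<open>t\<close>.\<close>
    ultimately have "t powr q * (C * a powr q) \<le> t powr q * (2 * t powr (p - q))"
      by (simp add: mult_ac)
    then have "C * a powr q \<le> 2 * t powr (p - q)"
      using t by simp
    with te have "C * a powr q \<le> C * e powr q" by linarith
    then have "a powr q \<le> e powr q" using C(1) by simp
    then have "a \<le> e"
      using powr_less_mono2[OF q(1), of e a] e by linarith
    then show "norm (A (x - coord_proj (supp x0) x) y) \<le> e" by (simp add: a_def)
  qed
qed

section \<open>Exchange of the variables and conclusion\<close>

lemma unit_ball_bilinear_forms_flip:
  assumes X: "normed_space_on X NX" and Y: "normed_space_on Y NY"
    and A: "A \<in> unit_ball (bilinear_forms X NX Y NY) (bilinear_norm X NX Y NY)"
  shows "(\<lambda>y x. A x y) \<in> unit_ball (bilinear_forms Y NY X NX) (bilinear_norm Y NY X NX)"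
proof -
  have A': "A \<in> bilinear_forms X NX Y NY" "bilinear_norm X NX Y NY A \<le> 1"
    using A by (auto simp: unit_ball_def)
  have "bilinear_norm Y NY X NX (\<lambda>y x. A x y) \<le> bilinear_norm X NX Y NY A"
    using norm_le_bilinear_norm[OF X Y A'(1)] by (intro bilinear_norm_le[OF Y X])
  then show ?thesis
    using A' bilinear_forms_flip[OF A'(1)] by (simp add: unit_ball_def)
qed

theorem theorem3p8:
  fixes X Y :: "(nat \<Rightarrow> 'k::real_or_complex) set"
    and NX NY :: "(nat \<Rightarrow> 'k) \<Rightarrow> real"
    and p q r s :: real
  assumes "banach_sequence_lattice X NX"
    and "banach_sequence_lattice Y NY"
    and "convex_const_one X NX p"
    and "convex_const_one Y NY s"
    and "convexity_power_type (dual_space Y NY) (dual_norm Y NY) q" and "2 \<le> q" and "q < p"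
    and "convexity_power_type (dual_space X NX) (dual_norm X NX) r" and "2 \<le> r" and "r < s"
  shows "\<forall>\<epsilon>>0. \<exists>\<eta>>0.
    \<forall>x0 \<in> unit_sphere X NX. \<forall>y0 \<in> unit_sphere Y NY.
    \<forall>A \<in> unit_ball (bilinear_forms X NX Y NY) (bilinear_norm X NX Y NY).
      finite (supp x0) \<and> finite (supp y0) \<and> norm (A x0 y0) > 1 - \<eta> \<longrightarrow>
      bilinear_norm X NX Y NY (A - restrict_form X Y (supp x0) (supp y0) A) < \<epsilon>"
proof (intro allI impI)
  fix \<epsilon> :: real assume \<epsilon>: "\<epsilon> > 0"
  note NX = banach_sequence_lattice_normed_space[OF assms(1)]
    and NY = banach_sequence_lattice_normed_space[OF assms(2)]
  \<comment> \<open>Two errors of a third each leave room for strictness: the supremum of the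
    pointwise bounds is at most two thirds of \<open>\<epsilon>\<close>.\<close>
  have pos: "0 < q" "0 < r" "0 < \<epsilon> / 3" using assms(6,9) \<epsilon> by auto
  obtain \<eta>1 where \<eta>1: "0 < \<eta>1"
    "\<forall>x0 \<in> unit_sphere X NX. \<forall>y0 \<in> unit_sphere Y NY.
      \<forall>A \<in> unit_ball (bilinear_forms X NX Y NY) (bilinear_norm X NX Y NY).
      finite (supp x0) \<and> norm (A x0 y0) > 1 - \<eta>1 \<longrightarrow>
      (\<forall>x \<in> unit_ball X NX. \<forall>y \<in> unit_ball Y NY.
        norm (A (x - coord_proj (supp x0) x) y) \<le> \<epsilon> / 3)"
    using bilinear_small_off_support[OF assms(1) NY assms(3,5) pos(1) assms(7) pos(3)]
    by (elim exE conjE)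
  \<comment> \<open>The same estimate with \<open>X\<close> and \<open>Y\<close> exchanged, to be
    applied to the flipped form.\<close>
  obtain \<eta>2 where \<eta>2: "0 < \<eta>2"
    "\<forall>x0 \<in> unit_sphere Y NY. \<forall>y0 \<in> unit_sphere X NX.
      \<forall>A \<in> unit_ball (bilinear_forms Y NY X NX) (bilinear_norm Y NY X NX).
      finite (supp x0) \<and> norm (A x0 y0) > 1 - \<eta>2 \<longrightarrow>
      (\<forall>x \<in> unit_ball Y NY. \<forall>y \<in> unit_ball X NX.
        norm (A (x - coord_proj (supp x0) x) y) \<le> \<epsilon> / 3)"
    using bilinear_small_off_support[OF assms(2) NX assms(4,8) pos(2) assms(10) pos(3)]
    by (elim exE conjE)
  have "bilinear_norm X NX Y NY (A - restrict_form X Y (supp x0) (supp y0) A) < \<epsilon>"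
    if x0: "x0 \<in> unit_sphere X NX" and y0: "y0 \<in> unit_sphere Y NY"
      and A: "A \<in> unit_ball (bilinear_forms X NX Y NY) (bilinear_norm X NX Y NY)"
      and fin: "finite (supp x0)" "finite (supp y0)"
      and att: "norm (A x0 y0) > 1 - min \<eta>1 \<eta>2" for x0 y0 A
  proof -
    have Ab: "A \<in> bilinear_forms X NX Y NY" using A by (simp add: unit_ball_def)
    note flip = unit_ball_bilinear_forms_flip[OF NX NY A]
    have att': "norm (A x0 y0) > 1 - \<eta>1" "norm (A x0 y0) > 1 - \<eta>2" using att by auto
    have "bilinear_norm X NX Y NY (A - restrict_form X Y (supp x0) (supp y0) A) \<le> 2 * \<epsilon> / 3"
    proof (rule bilinear_norm_le[OF NX NY])
      fix x y assume x: "x \<in> unit_ball X NX" and y: "y \<in> unit_ball Y NY"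
      let ?x = "coord_proj (supp x0) x" and ?y = "coord_proj (supp y0) y"
      note px = unit_ball_coord_proj[OF assms(1) fin(1) x]
        and py = unit_ball_coord_proj[OF assms(2) fin(2) y]
      have mem: "x \<in> X" "?x \<in> X" "x - ?x \<in> X" "y \<in> Y" "?y \<in> Y" "y - ?y \<in> Y"
        using x y px py by (auto simp: unit_ball_def)
      have "A (x - ?x + ?x) y = A (x - ?x) y + A ?x y"
        using bilinear_forms_linear(2)[OF Ab mem(4)] mem(2,3) by (simp only: linear_form_on_def)
      moreover have "A ?x (y - ?y + ?y) = A ?x (y - ?y) + A ?x ?y"
        using bilinear_forms_linear(1)[OF Ab mem(2)] mem(5,6) by (simp only: linear_form_on_def)
      ultimately have "norm ((A - restrict_form X Y (supp x0) (supp y0) A) x y)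
          = norm (A (x - ?x) y + A ?x (y - ?y))"
        using mem by (simp add: restrict_form_def)
      also have "\<dots> \<le> norm (A (x - ?x) y) + norm (A ?x (y - ?y))"
        by (rule norm_triangle_ineq)
      also have "\<dots> \<le> \<epsilon> / 3 + \<epsilon> / 3"
      proof (rule add_mono)
        show "norm (A (x - ?x) y) \<le> \<epsilon> / 3"
          by (rule \<eta>1(2)[rule_format, OF x0 y0 A conjI[OF fin(1) att'(1)] x y])
        \<comment> \<open>The projected vector \<open>?x\<close> stays in the unit ball, so it may
          serve as the free variable of the flipped estimate.\<close>
        show "norm (A ?x (y - ?y)) \<le> \<epsilon> / 3"
          by (rule \<eta>2(2)[rule_format, OF y0 x0 flip conjI[OF fin(2) att'(2)] y px(1)])
      qed
      finally show "norm ((A - restrict_form X Y (supp x0) (supp y0) A) x y) \<le> 2 * \<epsilon> / 3"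
        by simp
    qed
    then show ?thesis using \<epsilon> by simp
  qed
  then show "\<exists>\<eta>>0. \<forall>x0 \<in> unit_sphere X NX. \<forall>y0 \<in> unit_sphere Y NY.
    \<forall>A \<in> unit_ball (bilinear_forms X NX Y NY) (bilinear_norm X NX Y NY).
      finite (supp x0) \<and> finite (supp y0) \<and> norm (A x0 y0) > 1 - \<eta> \<longrightarrow>
      bilinear_norm X NX Y NY (A - restrict_form X Y (supp x0) (supp y0) A) < \<epsilon>"
    using \<eta>1(1) \<eta>2(1) by (intro exI[of _ "min \<eta>1 \<eta>2"] conjI ballI impI) (simp, blast)
qed

end
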